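(* Let $X$ be a three-dimensional real normed space with norm $\|\cdot\|$ and a normalized basis $e_1,e_2,e_3$ (i.e. $\|e_1\|=\|e_2\|=\|e_3\|=1$). For $x=(x_1,x_2,x_3)\in\mathbb{R}^3$ write $\|x\|=\|x_1e_1+x_2e_2+x_3e_3\|$, and let $\|x\|'_{x_1}(x_1,x_2,x_3)$ and $\|x\|''_{x_1^2}(x_1,x_2,x_3)$ denote the first and second partial derivatives of this function with respect to $x_1$ at $(x_1,x_2,x_3)$. Suppose that: (i) for every fixed $(x_2,x_3)\in\mathbb{R}^2\setminus\{0\}$, the function $x_1\mapsto\|x_1e_1+x_2e_2+x_3e_3\|$ has a continuous second derivative everywhere on $\mathbb{R}$, and $$\|x\|'_{x_1}(0,x_2,x_3)=\|x\|''_{x_1^2}(0,x_2,x_3)=0;$$ (ii) there exists a constant $K$ such that, for every $x_1\in\mathbb{R}$ and every $(x_2,x_3)\in\mathbb{R}^2$ with $\|x_2e_2+x_3e_3\|=1$, we have $\|x\|''_{x_1^2}(x_1,x_2,x_3)\le K$; (iii) the convergence in the limit $\lim_{x_1\to0}\|x\|''_{x_1^2}(x_1,x_2,x_3)=0$ is uniform with respect to $(x_2,x_3)\in\mathbb{R}^2$ with $\|x_2e_2+x_3e_3\|=1$. Then, for every $0<p\le2$, $X$ is not isometric to a subspace of $L_p$.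
   Context: All spaces are over the real numbers. $L_p=L_p([0,1])$ (Lebesgue measure), for $p>0$, with $\|f\|_p=(\int_0^1|f|^p)^{1/p}$ (a quasi-norm when $0<p<1$). A normed space $X$ is isometric to a subspace of $L_p$ (embeds isometrically in $L_p$) if there is a linear map $T:X\to L_p$ with $\|Tx\|_p=\|x\|$ for all $x\in X$. *)

theory Defs
  imports "HOL-Analysis.Analysis"
begin

text \<open>
  The spaces \<open>L\<^sub>p([0,1])\<close> are represented by functions rather than by equivalence classes
  modulo null sets, so equations between elements of \<open>L\<^sub>p\<close> are read almost everywhere.
\<close>

abbreviation leb01 :: "real measure"
  where "leb01 \<equiv> lebesgue_on {0..1}"

definition Lp_set :: "real \<Rightarrow> (real \<Rightarrow> real) set"
  where "Lp_set p =
    {f. f \<in> borel_measurable leb01 \<and> integrable leb01 (\<lambda>t. \<bar>f t\<bar> powr p)}"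

definition Lp_norm :: "real \<Rightarrow> (real \<Rightarrow> real) \<Rightarrow> real"
  where "Lp_norm p f = (\<integral>t. \<bar>f t\<bar> powr p \<partial>leb01) powr (1 / p)"

text \<open>
  A map into \<open>Lp_set p\<close> that is additive and homogeneous almost everywhere is a choice of
  representatives for a linear map into \<open>L\<^sub>p\<close>; the exceptional null set may depend on the
  vectors and scalars involved.
\<close>

definition linear_into_Lp :: "real \<Rightarrow> ('a::real_normed_vector \<Rightarrow> real \<Rightarrow> real) \<Rightarrow> bool"
  where "linear_into_Lp p T \<longleftrightarrow>
    (\<forall>x. T x \<in> Lp_set p) \<and>
    (\<forall>x y. AE t in leb01. T (x + y) t = T x t + T y t) \<and>
    (\<forall>c x. AE t in leb01. T (c *\<^sub>R x) t = c * T x t)"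

definition embeds_isometrically_in_Lp :: "'a::real_normed_vector itself \<Rightarrow> real \<Rightarrow> bool"
  where "embeds_isometrically_in_Lp _ p \<longleftrightarrow>
    (\<exists>T :: 'a \<Rightarrow> real \<Rightarrow> real. linear_into_Lp p T \<and> (\<forall>x. Lp_norm p (T x) = norm x))"

definition coord_norm :: "'a::real_normed_vector \<Rightarrow> 'a \<Rightarrow> 'a \<Rightarrow> real \<Rightarrow> real \<Rightarrow> real \<Rightarrow> real"
  where "coord_norm e1 e2 e3 x1 x2 x3 = norm (x1 *\<^sub>R e1 + x2 *\<^sub>R e2 + x3 *\<^sub>R e3)"

text \<open>
  First and second partial derivatives of \<open>coord_norm\<close> in the first coordinate. As \<open>deriv\<close> is
  total, their values are meaningful only where the derivatives exist.
\<close>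

definition coord_norm_d1 :: "'a::real_normed_vector \<Rightarrow> 'a \<Rightarrow> 'a \<Rightarrow> real \<Rightarrow> real \<Rightarrow> real \<Rightarrow> real"
  where "coord_norm_d1 e1 e2 e3 x1 x2 x3 = deriv (\<lambda>t. coord_norm e1 e2 e3 t x2 x3) x1"

definition coord_norm_d2 :: "'a::real_normed_vector \<Rightarrow> 'a \<Rightarrow> 'a \<Rightarrow> real \<Rightarrow> real \<Rightarrow> real \<Rightarrow> real"
  where "coord_norm_d2 e1 e2 e3 x1 x2 x3 = deriv (\<lambda>t. coord_norm_d1 e1 e2 e3 t x2 x3) x1"

definition twice_continuously_differentiable :: "(real \<Rightarrow> real) \<Rightarrow> bool"
  where "twice_continuously_differentiable f \<longleftrightarrow>
    (\<forall>t. f differentiable (at t)) \<and>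
    (\<forall>t. deriv f differentiable (at t)) \<and>
    continuous_on UNIV (deriv (deriv f))"

end

theory Submission
  imports Defs "HOL-Probability.Probability"
begin

text \<open>
  Write \<open>N s x y\<close> for the norm of \<open>s e1 + x e2 + y e3\<close> and suppose that
  \<open>N s x y\<close> to the power \<open>p\<close> is the integral over \<open>t\<close> of \<open>\<bar>s f + x g + y h\<bar>\<close> to the power \<open>p\<close>,
  where \<open>f, g, h\<close> are the images of the basis. Average over independent standard Gaussian
  \<open>x, y\<close> and let \<open>s\<close> tend to 0.

  On the left, the hypotheses make the increment of the average \<open>o(s\<^sup>2)\<close>: for \<open>r = N 0 x y\<close> the
  difference between the \<open>p\<close>-th powers of \<open>N s x y\<close> and \<open>r\<close> is \<open>o(s\<^sup>2)\<close> pointwise and dominated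
  by a multiple of \<open>s\<^sup>2 r\<^sup>p\<^sup>-\<^sup>2\<close>, which is Gaussian-integrable in two dimensions because \<open>p > 0\<close>.

  On the right, \<open>x g + y h\<close> is distributed as \<open>R Z\<close> with \<open>R\<^sup>2 = g\<^sup>2 + h\<^sup>2\<close> and \<open>Z\<close> standard normal, and
  the expectation of \<open>\<bar>s f + R Z\<bar>\<close> to the power \<open>p\<close> exceeds that of \<open>\<bar>R Z\<bar>\<close> to the power \<open>p\<close> by at least
  \<open>s\<^sup>2\<close> times a quantity that is positive wherever \<open>f \<noteq> 0\<close>. Hence \<open>f = 0\<close> almost everywhere, against
  \<open>\<parallel>e1\<parallel> = 1\<close>.
\<close>

subsection \<open>Elementary inequalities\<close>

text \<open>Chebyshev's association inequality: the nonnegative product of differences is averaged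
  first over \<open>x\<close>, then over an independent \<open>y\<close>. Averaging one variable at
  a time avoids the product space.\<close>

lemma (in prob_space) expectation_mult_ge_of_comonotone:
  fixes a b :: "'a \<Rightarrow> real"
  assumes [measurable]: "integrable M a" "integrable M b" "integrable M (\<lambda>x. a x * b x)"
    and comonotone: "\<And>x y. 0 \<le> (a x - a y) * (b x - b y)"
  shows "expectation a * expectation b \<le> expectation (\<lambda>x. a x * b x)"
proof -
  have *: "a y * expectation b + expectation a * b y \<le> expectation (\<lambda>x. a x * b x) + a y * b y" for y
  proof -
    have "0 \<le> expectation (\<lambda>x. (a x - a y) * (b x - b y))"
      by (intro integral_nonneg_AE) (simp add: comonotone)
    also have "\<dots> = expectation (\<lambda>x. a x * b x - a y * b x - a x * b y + a y * b y)"
      by (simp add: algebra_simps)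
    also have "\<dots> = expectation (\<lambda>x. a x * b x) - a y * expectation b - expectation a * b y + a y * b y"
      using assms by (simp add: prob_space)
    finally show ?thesis by simp
  qed
  have "expectation (\<lambda>y. a y * expectation b + expectation a * b y)
      \<le> expectation (\<lambda>y. expectation (\<lambda>x. a x * b x) + a y * b y)"
    using assms by (intro integral_mono * ) auto
  then show ?thesis
    using assms by (simp add: prob_space)
qed

lemma le_sinh:
  fixes x :: real
  assumes "0 \<le> x"
  shows "x \<le> sinh x"
proof -
  have "sinh 0 - 0 \<le> sinh x - x"
  proof (rule DERIV_nonneg_imp_nondecreasing[OF assms])
    fix u :: real
    have "((\<lambda>x. sinh x - x) has_real_derivative cosh u - 1) (at u)"
      by (auto intro!: derivative_eq_intros)
    then show "\<exists>y. ((\<lambda>x. sinh x - x) has_real_derivative y) (at u) \<and> 0 \<le> y"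
      using cosh_real_ge_1[of u] by (intro exI[of _ "cosh u - 1"]) auto
  qed
  then show ?thesis by simp
qed

text \<open>The derivative \<open>sinh u - u\<close> is nonnegative for \<open>u >= 0\<close>, and
  evenness covers the other sign. After removal of its quadratic Taylor term \<open>cosh\<close> is
  therefore still comonotone with powers of \<open>|x|\<close>.\<close>

lemma cosh_minus_half_square_mono:
  fixes x y :: real
  assumes "\<bar>x\<bar> \<le> \<bar>y\<bar>"
  shows "cosh x - x\<^sup>2 / 2 \<le> cosh y - y\<^sup>2 / 2"
proof -
  have "cosh \<bar>x\<bar> - \<bar>x\<bar>\<^sup>2 / 2 \<le> cosh \<bar>y\<bar> - \<bar>y\<bar>\<^sup>2 / 2"
  proof (rule DERIV_nonneg_imp_nondecreasing[OF assms])
    fix u :: real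
    assume "\<bar>x\<bar> \<le> u"
    have "((\<lambda>x. cosh x - x\<^sup>2 / 2) has_real_derivative sinh u - u) (at u)"
      by (auto intro!: derivative_eq_intros)
    then show "\<exists>y. ((\<lambda>x. cosh x - x\<^sup>2 / 2) has_real_derivative y) (at u) \<and> 0 \<le> y"
      using le_sinh[of u] \<open>\<bar>x\<bar> \<le> u\<close> by (intro exI[of _ "sinh u - u"]) auto
  qed
  then show ?thesis by (simp add: cosh_real_abs)
qed

text \<open>For these exponents \<open>z powr p\<close> lies between \<open>1\<close> and
  \<open>z^2\<close>, so its distance from \<open>1\<close> is at most
  \<open>|z^2 - 1|\<close>.\<close>

lemma abs_powr_minus_one_le:
  fixes z p :: real
  assumes "0 < p" "p \<le> 2" "0 \<le> z"
  shows "\<bar>z powr p - 1\<bar> \<le> \<bar>z - 1\<bar> * (z + 1)"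
proof -
  have sq: "\<bar>z - 1\<bar> * (z + 1) = \<bar>z\<^sup>2 - 1\<bar>"
  proof -
    have "\<bar>z\<^sup>2 - 1\<bar> = \<bar>(z - 1) * (z + 1)\<bar>"
      by (simp add: power2_eq_square algebra_simps)
    then show ?thesis using assms by (simp add: abs_mult)
  qed
  have z2: "z powr 2 = z\<^sup>2"
    using assms by (cases "z = 0") auto
  show ?thesis
  proof (cases "1 \<le> z")
    case True
    have "1 \<le> z powr p" using True assms by (simp add: ge_one_powr_ge_zero)
    moreover have "z powr p \<le> z powr 2" using True assms by (intro powr_mono) auto
    ultimately show ?thesis unfolding sq z2[symmetric] by simp
  next
    case False
    have "z powr p \<le> 1" using False assms by (intro powr_le1) auto
    moreover have "z powr 2 \<le> z powr p" using False assms
      by (intro powr_mono') auto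
    ultimately show ?thesis unfolding sq z2[symmetric] by simp
  qed
qed

text \<open>The mean value inequality is applied twice, first to \<open>deriv F\<close> and then to
  \<open>F\<close>.\<close>

lemma flat_function_bound:
  fixes F :: "real \<Rightarrow> real"
  assumes F: "twice_continuously_differentiable F" and F0: "deriv F 0 = 0"
    and bd: "\<And>u. \<bar>u\<bar> < d \<Longrightarrow> \<bar>deriv (deriv F) u\<bar> \<le> e" and s: "\<bar>s\<bar> < d"
  shows "\<bar>F s - F 0\<bar> \<le> e * s\<^sup>2"
proof -
  have D1: "(F has_real_derivative deriv F u) (at u within S)"
    and D2: "(deriv F has_real_derivative deriv (deriv F) u) (at u within S)" for u S
    using F unfolding twice_continuously_differentiable_def
    by (simp_all add: has_field_derivative_at_within DERIV_deriv_iff_real_differentiable)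
  have 1: "\<bar>deriv F u\<bar> \<le> e * \<bar>s\<bar>" if "\<bar>u\<bar> \<le> \<bar>s\<bar>" for u
  proof -
    have "norm (deriv F u - deriv F 0) \<le> e * norm (u - 0)"
      by (rule field_differentiable_bound[of "{-\<bar>s\<bar>..\<bar>s\<bar>}", OF _ D2]) (use bd s that in auto)
    also have "\<dots> \<le> e * \<bar>s\<bar>"
      using that bd[OF s] by (intro mult_left_mono) auto
    finally show ?thesis using F0 by simp
  qed
  have "norm (F s - F 0) \<le> (e * \<bar>s\<bar>) * norm (s - 0)"
    by (rule field_differentiable_bound[of "{-\<bar>s\<bar>..\<bar>s\<bar>}", OF _ D1]) (use 1 in auto)
  then show ?thesis by (simp add: power2_eq_square mult.assoc)
qed

subsection \<open>Gaussian averages of powers\<close>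

definition std_normal :: "real measure"
  where "std_normal = density lborel (\<lambda>x. ennreal (std_normal_density x))"

lemma sets_std_normal [measurable_cong, simp]: "sets std_normal = sets borel"
  and space_std_normal [simp]: "space std_normal = UNIV"
  by (simp_all add: std_normal_def)

interpretation std_normal: prob_space std_normal
  unfolding std_normal_def by (rule prob_space_normal_density) simp

lemma integrable_std_normal_iff:
  fixes F :: "real \<Rightarrow> real"
  assumes [measurable]: "F \<in> borel_measurable borel"
  shows "integrable std_normal F \<longleftrightarrow> integrable lborel (\<lambda>x. std_normal_density x * F x)"
  unfolding std_normal_def by (subst integrable_density) auto

lemma integral_std_normal:
  fixes F :: "real \<Rightarrow> real"
  assumes [measurable]: "F \<in> borel_measurable borel"
  shows "integral\<^sup>L std_normal F = (\<integral>x. std_normal_density x * F x \<partial>lborel)"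
  unfolding std_normal_def by (subst integral_density) auto

lemma std_normal_uminus:
  fixes F :: "real \<Rightarrow> real"
  assumes [measurable]: "F \<in> borel_measurable borel"
  shows "integrable std_normal (\<lambda>x. F (- x)) \<longleftrightarrow> integrable std_normal F"
    and "(\<integral>x. F (- x) \<partial>std_normal) = integral\<^sup>L std_normal F"
proof -
  have eq: "std_normal_density (- x) = std_normal_density x" for x
    by (simp add: std_normal_density_def)
  show "integrable std_normal (\<lambda>x. F (- x)) \<longleftrightarrow> integrable std_normal F"
    using lborel_integrable_real_affine_iff[of "-1" "\<lambda>x. std_normal_density x * F x" 0]
    by (simp add: integrable_std_normal_iff eq)
  show "(\<integral>x. F (- x) \<partial>std_normal) = integral\<^sup>L std_normal F"
    using lborel_integral_real_affine[of "-1" "\<lambda>x. std_normal_density x * F x" 0]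
    by (simp add: integral_std_normal eq)
qed

text \<open>The Cameron-Martin formula: by completing the square, translating the Gaussian by
  \<open>s\<close> multiplies its density by \<open>exp (s * x - s^2 / 2)\<close>.\<close>

lemma std_normal_shift:
  fixes F :: "real \<Rightarrow> real"
  assumes [measurable]: "F \<in> borel_measurable borel"
  shows "integrable std_normal (\<lambda>x. F (s + x)) \<longleftrightarrow> integrable std_normal (\<lambda>x. F x * exp (s * x))"
    and "(\<integral>x. F (s + x) \<partial>std_normal) = exp (- s\<^sup>2 / 2) * (\<integral>x. F x * exp (s * x) \<partial>std_normal)"
proof -
  have eq: "std_normal_density (s + x) * (F (s + x) * exp (s * (s + x)))
      = exp (s\<^sup>2 / 2) * (std_normal_density x * F (s + x))" for x
    by (simp add: std_normal_density_def flip: exp_add)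
       (simp add: power2_eq_square field_simps flip: exp_add)
  show "integrable std_normal (\<lambda>x. F (s + x)) \<longleftrightarrow> integrable std_normal (\<lambda>x. F x * exp (s * x))"
    using lborel_integrable_real_affine_iff[of 1 "\<lambda>x. std_normal_density x * (F x * exp (s * x))" s]
    by (simp add: integrable_std_normal_iff eq)
  show "(\<integral>x. F (s + x) \<partial>std_normal) = exp (- s\<^sup>2 / 2) * (\<integral>x. F x * exp (s * x) \<partial>std_normal)"
    using lborel_integral_real_affine[of 1 "\<lambda>x. std_normal_density x * (F x * exp (s * x))" s]
    by (simp only: eq) (simp add: integral_std_normal exp_minus)
qed

text \<open>Reflection preserves both the Gaussian and \<open>F\<close>, so
  \<open>exp (s * x)\<close> can be replaced by its even part.\<close>

lemma std_normal_shift_even: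
  fixes F :: "real \<Rightarrow> real"
  assumes [measurable]: "F \<in> borel_measurable borel" and even: "\<And>x. F (- x) = F x"
    and int: "integrable std_normal (\<lambda>x. F (s + x))"
  shows "integrable std_normal (\<lambda>x. F x * cosh (s * x))"
    and "(\<integral>x. F (s + x) \<partial>std_normal) = exp (- s\<^sup>2 / 2) * (\<integral>x. F x * cosh (s * x) \<partial>std_normal)"
proof -
  let ?G = "\<lambda>x. F x * exp (s * x)"
  have G: "integrable std_normal ?G"
    using int std_normal_shift(1) by simp
  have G': "integrable std_normal (\<lambda>x. ?G (- x))"
    by (subst std_normal_uminus(1)) (use G in auto)
  have eq: "F x * cosh (s * x) = (?G x + ?G (- x)) / 2" for x
    by (simp add: even cosh_def algebra_simps)
  show "integrable std_normal (\<lambda>x. F x * cosh (s * x))"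
    unfolding eq using G G' by auto
  have "(\<integral>x. F x * cosh (s * x) \<partial>std_normal) = (integral\<^sup>L std_normal ?G + (\<integral>x. ?G (- x) \<partial>std_normal)) / 2"
    unfolding eq using G G' by simp
  also have "(\<integral>x. ?G (- x) \<partial>std_normal) = integral\<^sup>L std_normal ?G"
    by (rule std_normal_uminus(2)) simp
  finally show "(\<integral>x. F (s + x) \<partial>std_normal) = exp (- s\<^sup>2 / 2) * (\<integral>x. F x * cosh (s * x) \<partial>std_normal)"
    by (simp add: std_normal_shift(2))
qed

lemma integrable_std_normal_power: "integrable std_normal (\<lambda>x. x ^ k)"
  using integrable_std_normal_moment by (simp add: integrable_std_normal_iff)

lemma powr_le_1_plus_square:
  fixes z p :: real
  assumes "0 < p" "p \<le> 2"
  shows "\<bar>z\<bar> powr p \<le> 1 + z\<^sup>2"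
proof (cases "\<bar>z\<bar> \<le> 1")
  case True
  then have "\<bar>z\<bar> powr p \<le> 1" using assms by (intro powr_le1) auto
  then show ?thesis by (simp add: add_increasing2)
next
  case False
  then have "\<bar>z\<bar> powr p \<le> \<bar>z\<bar> powr 2" using assms by (intro powr_mono) auto
  also have "\<dots> = z\<^sup>2" using False by (simp)
  finally show ?thesis by simp
qed

lemma integrable_std_normal_shift_powr:
  assumes "0 < p" "p \<le> 2"
  shows "integrable std_normal (\<lambda>x. \<bar>s + r * x\<bar> powr p)"
proof (rule Bochner_Integration.integrable_bound)
  show "integrable std_normal (\<lambda>x. 1 + (s + r * x)\<^sup>2)"
    using integrable_std_normal_power[of 1] integrable_std_normal_power[of 2]
    by (simp add: power2_sum power_mult_distrib algebra_simps)
  show "AE x in std_normal. norm (\<bar>s + r * x\<bar> powr p) \<le> norm (1 + (s + r * x)\<^sup>2)"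
    using powr_le_1_plus_square[OF assms] by (intro AE_I2) (auto intro: order_trans)
qed simp

text \<open>This is \<open>p\<close> times the absolute moment of order \<open>p\<close>; only its sign matters.\<close>

definition moment_gap :: "real \<Rightarrow> real"
  where "moment_gap p = (\<integral>x. \<bar>x\<bar> powr p * (x\<^sup>2 - 1) \<partial>std_normal)"

lemma integral_std_normal_square: "(\<integral>x. x\<^sup>2 \<partial>std_normal) = 1"
  using integral_std_normal_moment_even[of 1] by (simp add: integral_std_normal)

lemma integrable_std_normal_powr_square:
  assumes "0 < p" "p \<le> 2"
  shows "integrable std_normal (\<lambda>x. \<bar>x\<bar> powr p * x\<^sup>2)"
proof (rule Bochner_Integration.integrable_bound)
  show "integrable std_normal (\<lambda>x. x ^ 2 + x ^ 4)"
    using integrable_std_normal_power by auto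
  have "\<bar>x\<bar> powr p * x\<^sup>2 \<le> x ^ 2 + x ^ 4" for x :: real
    using mult_right_mono[OF powr_le_1_plus_square[OF assms, of x], of "x\<^sup>2"]
    by (simp add: algebra_simps flip: power_add)
  then show "AE x in std_normal. norm (\<bar>x\<bar> powr p * x\<^sup>2) \<le> norm (x ^ 2 + x ^ 4)"
    by (intro AE_I2) (auto intro: order_trans)
qed simp

text \<open>Since \<open>x^2 - 1\<close> has Gaussian mean 0, \<open>|x| powr p\<close> may be
  replaced by \<open>|x| powr p - 1\<close>. The two factors of the integrand then have equal sign,
  and they vanish only on the null set \<open>|x| = 1\<close>.\<close>

lemma moment_gap_pos:
  assumes "0 < p" "p \<le> 2"
  shows "0 < moment_gap p"
proof -
  note int = integrable_std_normal_shift_powr[OF assms, of 0 1, simplified]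
    integrable_std_normal_powr_square[OF assms] integrable_std_normal_power[of 2]
  let ?G = "\<lambda>x::real. (\<bar>x\<bar> powr p - 1) * (x\<^sup>2 - 1)"
  have G: "?G x = \<bar>x\<bar> powr p * x\<^sup>2 - \<bar>x\<bar> powr p - x\<^sup>2 + 1" for x
    by (simp add: algebra_simps)
  have intG: "integrable std_normal ?G"
    unfolding G using int by auto
  have gap: "moment_gap p = integral\<^sup>L std_normal ?G"
    unfolding G moment_gap_def using int std_normal.prob_space
    by (simp add: integral_std_normal_square right_diff_distrib)
  have zero: "?G x = 0 \<longleftrightarrow> \<bar>x\<bar> = 1" and nonneg: "0 \<le> ?G x" for x
  proof -
    consider "\<bar>x\<bar> = 1" | "1 < \<bar>x\<bar>" | "\<bar>x\<bar> < 1" by linarith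
    then have "(?G x = 0 \<longleftrightarrow> \<bar>x\<bar> = 1) \<and> 0 \<le> ?G x"
    proof cases
      case 2
      then have "1 < \<bar>x\<bar> powr p" "1 < x\<^sup>2"
        using assms powr_less_mono2[of p 1 "\<bar>x\<bar>"] abs_square_le_1[of x] by auto
      then have "0 < ?G x" by simp
      then show ?thesis using 2 by linarith
    next
      case 3
      then have "\<bar>x\<bar> powr p < 1" "x\<^sup>2 < 1"
        using assms powr_less_mono2[of p "\<bar>x\<bar>" 1] by (simp_all add: abs_square_less_1)
      then have "0 < ?G x" by (simp add: mult_neg_neg)
      then show ?thesis using 3 by linarith
    qed (auto simp: power2_eq_1_iff abs_if split: if_splits)
    then show "?G x = 0 \<longleftrightarrow> \<bar>x\<bar> = 1" "0 \<le> ?G x" by auto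
  qed
  have "integral\<^sup>L std_normal ?G \<noteq> 0"
  proof
    assume "integral\<^sup>L std_normal ?G = 0"
    then have "AE x in std_normal. \<bar>x\<bar> = 1"
      using integral_nonneg_eq_0_iff_AE[OF intG] nonneg zero by auto
    then have "AE x in lborel. \<bar>x::real\<bar> = 1"
      unfolding std_normal_def by (subst (asm) AE_density) (auto simp: normal_density_pos)
    moreover have "AE x in lborel. x \<noteq> (1::real)" "AE x in lborel. x \<noteq> (-1::real)"
      by (rule AE_lborel_singleton)+
    ultimately have "AE x in lborel :: real measure. False"
      by eventually_elim auto
    then show False by (simp add: AE_iff_null null_sets_def)
  qed
  moreover have "0 \<le> integral\<^sup>L std_normal ?G"
    using nonneg by (intro integral_nonneg_AE) auto
  ultimately show ?thesis by (simp add: gap)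
qed

text \<open>
  The shift turns the right-hand side below into the expectation of \<open>\<bar>Z\<bar>\<^sup>p cosh (s Z)\<close> up to a factor.
  Chebyshev's association inequality is applied to \<open>cosh (s Z) - (s Z)\<^sup>2 / 2\<close>, which still increases
  with \<open>\<bar>Z\<bar>\<close>; the quadratic term split off provides the strict gain.
\<close>

lemma integral_std_normal_shift_powr_ge:
  assumes p: "0 < p" "p \<le> 2"
  shows "(\<integral>x. \<bar>x\<bar> powr p \<partial>std_normal) + exp (- s\<^sup>2 / 2) * (s\<^sup>2 / 2) * moment_gap p
    \<le> (\<integral>x. \<bar>s + x\<bar> powr p \<partial>std_normal)"
proof -
  let ?a = "\<lambda>x::real. \<bar>x\<bar> powr p" and ?b = "\<lambda>x. cosh (s * x) - (s * x)\<^sup>2 / 2"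
  note int = integrable_std_normal_shift_powr[OF p, of 0 1, simplified]
    integrable_std_normal_powr_square[OF p] integrable_std_normal_power[of 2]
  note sh = std_normal_shift_even[of ?a s, OF _ _ integrable_std_normal_shift_powr[OF p, of s 1, simplified], simplified]
  \<comment> \<open>For the constant function 1 the shift formula evaluates the mean of
    \<open>cosh (s * x)\<close>.\<close>
  note sh1 = std_normal_shift_even[of "\<lambda>_. 1" s, simplified, unfolded std_normal.prob_space]
  have b: "integrable std_normal ?b"
    using int sh1 by (simp add: power_mult_distrib)
  have ab_eq: "?a x * ?b x = ?a x * cosh (s * x) - s\<^sup>2 / 2 * (?a x * x\<^sup>2)" for x
    by (simp add: algebra_simps power_mult_distrib)
  have ab: "integrable std_normal (\<lambda>x. ?a x * ?b x)"
    unfolding ab_eq using int sh by simp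
  have cosh: "(\<integral>x. cosh (s * x) \<partial>std_normal) = exp (s\<^sup>2 / 2)"
    using sh1(2) std_normal.prob_space by (simp add: exp_minus field_simps)
  have Eb: "integral\<^sup>L std_normal ?b = exp (s\<^sup>2 / 2) - s\<^sup>2 / 2"
    using int sh1 cosh by (simp add: power_mult_distrib integral_std_normal_square)
  have gap: "moment_gap p = (\<integral>x. ?a x * x\<^sup>2 \<partial>std_normal) - integral\<^sup>L std_normal ?a"
    unfolding moment_gap_def using int by (simp add: right_diff_distrib)
  have "integral\<^sup>L std_normal ?a * integral\<^sup>L std_normal ?b \<le> (\<integral>x. ?a x * ?b x \<partial>std_normal)"
  proof (rule std_normal.expectation_mult_ge_of_comonotone[OF int(1) b ab])
    fix x y :: real
    show "0 \<le> (?a x - ?a y) * (?b x - ?b y)"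
    proof (cases "\<bar>x\<bar> \<le> \<bar>y\<bar>")
      case True
      then have "?a x \<le> ?a y" "?b x \<le> ?b y"
        using p by (auto intro!: powr_mono2 cosh_minus_half_square_mono mult_left_mono simp: abs_mult)
      then show ?thesis by (simp add: mult_nonpos_nonpos)
    next
      case False
      then have "?a y \<le> ?a x" "?b y \<le> ?b x"
        using p by (auto intro!: powr_mono2 cosh_minus_half_square_mono mult_left_mono simp: abs_mult)
      then show ?thesis by simp
    qed
  qed
  also have "(\<integral>x. ?a x * ?b x \<partial>std_normal)
      = (\<integral>x. ?a x * cosh (s * x) \<partial>std_normal) - s\<^sup>2 / 2 * (\<integral>x. ?a x * x\<^sup>2 \<partial>std_normal)"
    unfolding ab_eq using int sh by simp
  \<comment> \<open>The terms with factor \<open>s^2 / 2\<close>, one from each side, combine to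
    \<open>moment_gap p\<close>.\<close>
  finally have "integral\<^sup>L std_normal ?a * exp (s\<^sup>2 / 2) + (s\<^sup>2 / 2) * moment_gap p
      \<le> (\<integral>x. ?a x * cosh (s * x) \<partial>std_normal)"
    unfolding Eb gap by (simp add: algebra_simps)
  then have "exp (- s\<^sup>2 / 2) * (integral\<^sup>L std_normal ?a * exp (s\<^sup>2 / 2) + (s\<^sup>2 / 2) * moment_gap p)
      \<le> exp (- s\<^sup>2 / 2) * (\<integral>x. ?a x * cosh (s * x) \<partial>std_normal)"
    by (rule mult_left_mono) simp
  then show ?thesis
    unfolding sh(2) by (simp add: algebra_simps exp_minus)
qed

section \<open>Linear combinations of independent Gaussians\<close>

text \<open>Puts the coordinates into the form in which sums of independent normal variables are
  treated. The second marginal is reduced to the first by swapping coordinates.\<close>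

lemma distributed_std_normal_pair:
  shows "distributed (std_normal \<Otimes>\<^sub>M std_normal) lborel fst std_normal_density"
    and "distributed (std_normal \<Otimes>\<^sub>M std_normal) lborel snd std_normal_density"
    and "prob_space.indep_var (std_normal \<Otimes>\<^sub>M std_normal) borel fst borel snd"
proof -
  interpret P: pair_prob_space std_normal std_normal ..
  have cong: "distr M lborel f = distr M borel f" for M and f :: "'a \<Rightarrow> real"
    by (rule distr_cong) auto
  have 1: "distr (std_normal \<Otimes>\<^sub>M std_normal) borel fst = std_normal"
    using std_normal.distr_pair_fst[of std_normal]
      distr_cong[of "std_normal \<Otimes>\<^sub>M std_normal" "std_normal \<Otimes>\<^sub>M std_normal" borel std_normal fst fst]
    by simp
  have 2: "distr (std_normal \<Otimes>\<^sub>M std_normal) borel snd = std_normal"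
  proof -
    have "std_normal = distr (distr (std_normal \<Otimes>\<^sub>M std_normal) (std_normal \<Otimes>\<^sub>M std_normal) (\<lambda>(x, y). (y, x))) borel fst"
      by (simp flip: P.distr_pair_swap add: 1)
    also have "\<dots> = distr (std_normal \<Otimes>\<^sub>M std_normal) borel snd"
      by (subst distr_distr) (auto simp: comp_def split_beta)
    finally show ?thesis ..
  qed
  show "distributed (std_normal \<Otimes>\<^sub>M std_normal) lborel fst std_normal_density"
    using 1 by (simp add: distributed_def cong std_normal_def[symmetric])
  show "distributed (std_normal \<Otimes>\<^sub>M std_normal) lborel snd std_normal_density"
    using 2 by (simp add: distributed_def cong std_normal_def[symmetric])
  show "P.indep_var borel fst borel snd"
    unfolding P.indep_var_distribution_eq 1 2
    by (auto intro!: distr_id2[symmetric] sets_pair_measure_cong)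
qed

text \<open>Both arguments of \<open>F\<close> have the centered normal distribution with deviation
  \<open>sqrt (g^2 + h^2)\<close>. Nonnegative integrals spare any integrability condition on
  \<open>F\<close>.\<close>

lemma nn_integral_std_normal_lincomb:
  fixes F :: "real \<Rightarrow> ennreal"
  assumes F [measurable]: "F \<in> borel_measurable borel"
  shows "(\<integral>\<^sup>+w. F (g * fst w + h * snd w) \<partial>(std_normal \<Otimes>\<^sub>M std_normal))
    = (\<integral>\<^sup>+z. F (sqrt (g\<^sup>2 + h\<^sup>2) * z) \<partial>std_normal)"
proof -
  interpret P: pair_prob_space std_normal std_normal ..
  let ?P = "std_normal \<Otimes>\<^sub>M std_normal" and ?R = "sqrt (g\<^sup>2 + h\<^sup>2)"
  have aff: "distributed M lborel (\<lambda>x. c * X x) (normal_density 0 \<bar>c\<bar>)"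
    if "prob_space M" "distributed M lborel X std_normal_density" "c \<noteq> 0"
    for M :: "'b measure" and X c
    using prob_space.normal_density_affine[OF that(1,2), of c 0] that(3) by simp
  show ?thesis
  proof (cases "g = 0 \<and> h = 0")
    case True
    then show ?thesis
      using P.emeasure_space_1 std_normal.emeasure_space_1 by (simp add: space_pair_measure)
  next
    case False
    then have R: "0 < ?R" by (simp add: sum_power2_gt_zero_iff)
    have dist: "distributed ?P lborel (\<lambda>w. g * fst w + h * snd w) (normal_density 0 ?R)"
    proof -
      \<comment> \<open>The sum rule requires positive deviations, so if one coefficient vanishes
        the variable is treated as a single scaled Gaussian.\<close>
      consider "g = 0" "h \<noteq> 0" | "g \<noteq> 0" "h = 0" | "g \<noteq> 0" "h \<noteq> 0" using False by blast
      then show ?thesis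
      proof cases
        case 3
        have "P.indep_var borel ((\<lambda>x. g * x) \<circ> fst) borel ((\<lambda>x. h * x) \<circ> snd)"
          by (rule P.indep_var_compose[OF distributed_std_normal_pair(3)]) auto
        from P.add_indep_normal[OF this[unfolded comp_def] _ _
            aff[OF P.prob_space_axioms distributed_std_normal_pair(1)]
            aff[OF P.prob_space_axioms distributed_std_normal_pair(2)]] 3
        show ?thesis by simp
      qed (use aff[OF P.prob_space_axioms distributed_std_normal_pair(1)]
          aff[OF P.prob_space_axioms distributed_std_normal_pair(2)] in auto)
    qed
    have "distributed std_normal lborel (\<lambda>x. x) std_normal_density"
      by (auto simp: distributed_def std_normal_def[symmetric] intro!: distr_id2)
    from aff[OF std_normal.prob_space_axioms this, of ?R]
    have "distributed std_normal lborel (\<lambda>x. ?R * x) (normal_density 0 ?R)"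
      using R by (simp only: abs_of_pos less_imp_neq[symmetric] simp_thms)
    from distributed_nn_integral[OF this] distributed_nn_integral[OF dist] F
    show ?thesis by simp
  qed
qed

section \<open>Growth of the average for frozen coefficients\<close>

text \<open>Factoring out \<open>r\<close> reduces this to the standard Gaussian shifted by
  \<open>s / r\<close>.\<close>

lemma integral_std_normal_affine_powr_ge:
  assumes p: "0 < p" "p \<le> 2" and "0 < r"
  shows "(\<integral>x. \<bar>r * x\<bar> powr p \<partial>std_normal)
      + r powr p * (exp (- (s / r)\<^sup>2 / 2) * ((s / r)\<^sup>2 / 2) * moment_gap p)
    \<le> (\<integral>x. \<bar>s + r * x\<bar> powr p \<partial>std_normal)"
proof -
  have eq: "\<bar>s + r * x\<bar> powr p = r powr p * \<bar>s / r + x\<bar> powr p" for s x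
  proof -
    have "s + r * x = r * (s / r + x)" using \<open>0 < r\<close> by (simp add: field_simps)
    then show ?thesis using \<open>0 < r\<close> by (simp add: abs_mult powr_mult)
  qed
  have "r powr p * ((\<integral>x. \<bar>x\<bar> powr p \<partial>std_normal)
      + exp (- (s / r)\<^sup>2 / 2) * ((s / r)\<^sup>2 / 2) * moment_gap p)
    \<le> r powr p * (\<integral>x. \<bar>s / r + x\<bar> powr p \<partial>std_normal)"
    by (intro mult_left_mono integral_std_normal_shift_powr_ge p) auto
  then show ?thesis
    unfolding eq eq[of 0, simplified] by (simp add: distrib_left)
qed

text \<open>
  A lower bound, uniform in \<open>0 < s \<le> 1\<close>, for the increment divided by \<open>s\<^sup>2\<close> when \<open>g, h, f\<close> are frozen;
  at \<open>r = 0\<close> the increment is \<open>\<bar>s f\<bar>\<^sup>p\<close>, which is at least \<open>s\<^sup>2 \<bar>f\<bar>\<^sup>p\<close>.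
\<close>

definition lower_density :: "real \<Rightarrow> real \<Rightarrow> real \<Rightarrow> real"
  where "lower_density p r f = (if r = 0 then \<bar>f\<bar> powr p
    else r powr p * (exp (- (f / r)\<^sup>2 / 2) * ((f / r)\<^sup>2 / 2) * moment_gap p))"

lemma lower_density_nonneg: "0 < p \<Longrightarrow> p \<le> 2 \<Longrightarrow> 0 \<le> lower_density p r f"
  using moment_gap_pos[of p] by (simp add: lower_density_def)

lemma lower_density_pos: "0 < p \<Longrightarrow> p \<le> 2 \<Longrightarrow> f \<noteq> 0 \<Longrightarrow> 0 < lower_density p r f"
  using moment_gap_pos[of p] by (simp add: lower_density_def)

lemma lower_density_measurable [measurable]:
  "(\<lambda>x. lower_density p (fst x) (snd x)) \<in> borel_measurable (borel \<Otimes>\<^sub>M borel)"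
  unfolding lower_density_def by measurable

text \<open>For \<open>r = 0\<close> the gain is \<open>s powr p * |f| powr p\<close>, and
  \<open>s^2 <= s powr p\<close> because \<open>s <= 1\<close>. For \<open>r > 0\<close> the
  exponential factor decreases in \<open>s\<close>, so its value at \<open>s = 1\<close> serves for
  all \<open>s\<close> and keeps \<open>lower_density\<close> independent of
  \<open>s\<close>.\<close>

lemma nn_integral_std_normal_affine_powr_ge:
  assumes p: "0 < p" "p \<le> 2" and r: "0 \<le> r" and s: "0 < s" "s \<le> 1"
  shows "(\<integral>\<^sup>+x. ennreal (\<bar>r * x\<bar> powr p) \<partial>std_normal) + ennreal (s\<^sup>2 * lower_density p r f)
    \<le> (\<integral>\<^sup>+x. ennreal (\<bar>s * f + r * x\<bar> powr p) \<partial>std_normal)"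
proof -
  have nn: "(\<integral>\<^sup>+x. ennreal (\<bar>t + r * x\<bar> powr p) \<partial>std_normal)
      = ennreal (\<integral>x. \<bar>t + r * x\<bar> powr p \<partial>std_normal)" for t
    by (intro nn_integral_eq_integral integrable_std_normal_shift_powr p) auto
  have "(\<integral>x. \<bar>r * x\<bar> powr p \<partial>std_normal) + s\<^sup>2 * lower_density p r f
    \<le> (\<integral>x. \<bar>s * f + r * x\<bar> powr p \<partial>std_normal)"
  proof (cases "r = 0")
    case True
    have "s\<^sup>2 = s powr 2" using s by simp
    also have "\<dots> \<le> s powr p" using s p by (intro powr_mono') auto
    finally have "s\<^sup>2 * \<bar>f\<bar> powr p \<le> s powr p * \<bar>f\<bar> powr p"
      by (rule mult_right_mono) simp
    then show ?thesis
      using True s p std_normal.prob_space by (simp add: lower_density_def abs_mult powr_mult)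
  next
    case False
    with r have r: "0 < r" by simp
    have "s\<^sup>2 * lower_density p r f
        = r powr p * (exp (- (f / r)\<^sup>2 / 2) * ((s * f / r)\<^sup>2 / 2) * moment_gap p)"
      using False by (simp add: lower_density_def power_mult_distrib power_divide)
    also have "\<dots> \<le> r powr p * (exp (- (s * f / r)\<^sup>2 / 2) * ((s * f / r)\<^sup>2 / 2) * moment_gap p)"
    proof -
      have "s\<^sup>2 * (f / r)\<^sup>2 \<le> 1 * (f / r)\<^sup>2"
        using s by (intro mult_right_mono) (auto simp: abs_square_le_1)
      then have "(s * f / r)\<^sup>2 \<le> (f / r)\<^sup>2" by (simp add: power_mult_distrib power_divide)
      then show ?thesis
        using moment_gap_pos[OF p] by (intro mult_left_mono mult_right_mono) auto
    qed
    finally show ?thesis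
      using integral_std_normal_affine_powr_ge[OF p r, of "s * f"] by simp
  qed
  then show ?thesis
    unfolding nn nn[of 0, simplified] using lower_density_nonneg[OF p]
    by (subst ennreal_plus[symmetric]) (auto intro!: ennreal_leI simp del: ennreal_plus)
qed

section \<open>Gaussian integrability of singular powers\<close>

text \<open>For \<open>0 < |x| <= 1\<close> the density is at most 1 and the power is integrable
  because \<open>a > -1\<close>; for \<open>|x| >= 1\<close> the power is at most 1.
  \<open>G\<close> and its reflection represent the singular part on the two sides of 0.\<close>

lemma integrable_std_normal_powr_neg:
  fixes a :: real
  assumes a: "-1 < a" "a \<le> 0"
  shows "integrable std_normal (\<lambda>x. \<bar>x\<bar> powr a)"
proof -
  define G where "G = (\<lambda>x::real. indicator {0<..1} x *\<^sub>R x powr a)"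
  have "set_integrable lebesgue {0<..1} (\<lambda>x. x powr a)"
    using integrable_on_powr_from_0'[OF a(1), of 1]
    by (intro nonnegative_absolutely_integrable_1) auto
  then have "integrable lebesgue G" by (simp add: set_integrable_def G_def)
  then have G: "integrable lborel G" by (subst (asm) integrable_completion) (auto simp: G_def)
  have G': "integrable lborel (\<lambda>x. G (- x))"
    using lborel_integrable_real_affine[OF G, of "-1" 0] by simp
  have "integrable lborel (\<lambda>x. std_normal_density x * \<bar>x\<bar> powr a)"
  proof (rule Bochner_Integration.integrable_bound)
    show "integrable lborel (\<lambda>x. G x + G (- x) + std_normal_density x)"
      using G G' by simp
    have "std_normal_density x * \<bar>x\<bar> powr a \<le> G x + G (- x) + std_normal_density x" for x
    proof -
      have G0: "0 \<le> G x" "0 \<le> G (- x)" by (simp_all add: G_def)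
      have d1: "std_normal_density x \<le> 1"
      proof -
        have "1 \<le> sqrt (2 * pi)" using pi_gt3 by simp
        then have "1 / sqrt (2 * pi) * exp (- x\<^sup>2 / 2) \<le> 1 * 1"
          by (intro mult_mono) auto
        then show ?thesis by (simp add: std_normal_density_def)
      qed
      consider "x = 0" | "0 < x" "x \<le> 1" | "x < 0" "-1 \<le> x" | "1 \<le> \<bar>x\<bar>" by linarith
      then show ?thesis
      proof cases
        \<comment> \<open>By convention \<open>0 powr a = 0\<close>.\<close>
        case 1 then show ?thesis using G0 by simp
      next
        case 2
        then have "\<bar>x\<bar> powr a = G x" by (simp add: G_def)
        moreover have "std_normal_density x * G x \<le> 1 * G x"
          using d1 G0 by (intro mult_right_mono) auto
        ultimately show ?thesis using G0 normal_density_nonneg[of 0 1 x] by (simp only:)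
      next
        case 3
        then have "\<bar>x\<bar> powr a = G (- x)" by (simp add: G_def)
        moreover have "std_normal_density x * G (- x) \<le> 1 * G (- x)"
          using d1 G0 by (intro mult_right_mono) auto
        ultimately show ?thesis using G0 normal_density_nonneg[of 0 1 x] by (simp only:)
      next
        case 4
        then have "\<bar>x\<bar> powr a \<le> \<bar>x\<bar> powr 0" using a by (intro powr_mono) auto
        then have "\<bar>x\<bar> powr a \<le> 1" using 4 by (auto split: if_splits)
        then have "std_normal_density x * \<bar>x\<bar> powr a \<le> std_normal_density x * 1"
          by (intro mult_left_mono) auto
        then show ?thesis using G0 by simp
      qed
    qed
    then show "AE x in lborel. norm (std_normal_density x * \<bar>x\<bar> powr a)
        \<le> norm (G x + G (- x) + std_normal_density x)"
      by (intro AE_I2) (auto intro: order_trans[OF _ abs_ge_self])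
  qed simp
  then show ?thesis by (simp add: integrable_std_normal_iff)
qed

text \<open>A product of two one-dimensional singularities will dominate the negative power of the
  norm on the plane, in place of polar coordinates.\<close>

lemma integrable_std_normal_pair_powr_neg:
  fixes a :: real
  assumes a: "-1 < a" "a \<le> 0"
  shows "integrable (std_normal \<Otimes>\<^sub>M std_normal) (\<lambda>w. \<bar>fst w\<bar> powr a * \<bar>snd w\<bar> powr a)"
proof -
  interpret P: pair_prob_space std_normal std_normal ..
  note int = integrable_std_normal_powr_neg[OF a]
  show ?thesis
    by (rule P.Fubini_integrable) (use int in \<open>auto simp: abs_mult\<close>)
qed

text \<open>Discards the coordinate axes, where the convention \<open>0 powr a = 0\<close> would
  make the product of negative powers useless as a bound.\<close>

lemma AE_std_normal_pair_nonzero: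
  "AE w in std_normal \<Otimes>\<^sub>M std_normal. fst w \<noteq> 0 \<and> snd w \<noteq> 0"
proof -
  interpret P: pair_prob_space std_normal std_normal ..
  have 0: "AE x in lborel. 0 < ennreal (std_normal_density x) \<longrightarrow> x \<noteq> 0"
    using AE_lborel_singleton[of 0] by auto
  show ?thesis
    using P.distributed_AE2[OF distributed_std_normal_pair(1), of "\<lambda>x. x \<noteq> 0"]
      P.distributed_AE2[OF distributed_std_normal_pair(2), of "\<lambda>x. x \<noteq> 0"] 0
    by auto
qed

section \<open>Gaussian averages of integrals of powers\<close>

text \<open>Tonelli brings the Gaussian average inside; for each fixed \<open>t\<close> the
  combination of \<open>g t\<close> and \<open>h t\<close> then has the law of one scaled
  Gaussian.\<close>

lemma nn_integral_std_normal_pair_swap: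
  fixes f g h :: "'b \<Rightarrow> real"
  assumes M: "sigma_finite_measure M"
    and [measurable]: "f \<in> borel_measurable M" "g \<in> borel_measurable M" "h \<in> borel_measurable M"
  shows "(\<integral>\<^sup>+w. \<integral>\<^sup>+t. ennreal (\<bar>s * f t + fst w * g t + snd w * h t\<bar> powr p) \<partial>M
        \<partial>(std_normal \<Otimes>\<^sub>M std_normal))
    = (\<integral>\<^sup>+t. \<integral>\<^sup>+z. ennreal (\<bar>s * f t + sqrt ((g t)\<^sup>2 + (h t)\<^sup>2) * z\<bar> powr p) \<partial>std_normal \<partial>M)"
proof -
  interpret M: sigma_finite_measure M by fact
  interpret P: pair_prob_space std_normal std_normal ..
  interpret PM: pair_sigma_finite "std_normal \<Otimes>\<^sub>M std_normal" M ..
  have "(\<integral>\<^sup>+w. \<integral>\<^sup>+t. ennreal (\<bar>s * f t + fst w * g t + snd w * h t\<bar> powr p) \<partial>M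
        \<partial>(std_normal \<Otimes>\<^sub>M std_normal))
    = (\<integral>\<^sup>+t. \<integral>\<^sup>+w. ennreal (\<bar>s * f t + fst w * g t + snd w * h t\<bar> powr p)
        \<partial>(std_normal \<Otimes>\<^sub>M std_normal) \<partial>M)"
    by (rule PM.Fubini'[symmetric]) measurable
  also have "\<dots> = (\<integral>\<^sup>+t. \<integral>\<^sup>+z. ennreal (\<bar>s * f t + sqrt ((g t)\<^sup>2 + (h t)\<^sup>2) * z\<bar> powr p) \<partial>std_normal \<partial>M)"
    using nn_integral_std_normal_lincomb[of "\<lambda>u. ennreal (\<bar>s * f t + u\<bar> powr p)" "g t" "h t" for t]
    by (intro nn_integral_cong) (simp add: add.assoc mult.commute)
  finally show ?thesis .
qed

text \<open>After the swap, the bound for frozen values of \<open>f\<close>, \<open>g\<close>,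
  \<open>h\<close> is integrated over \<open>t\<close>.\<close>

lemma nn_integral_std_normal_pair_growth:
  fixes f g h :: "'b \<Rightarrow> real"
  assumes M: "sigma_finite_measure M"
    and [measurable]: "f \<in> borel_measurable M" "g \<in> borel_measurable M" "h \<in> borel_measurable M"
    and p: "0 < p" "p \<le> 2" and s: "0 < s" "s \<le> 1"
  defines "J \<equiv> \<lambda>s. \<integral>\<^sup>+w. \<integral>\<^sup>+t. ennreal (\<bar>s * f t + fst w * g t + snd w * h t\<bar> powr p) \<partial>M
        \<partial>(std_normal \<Otimes>\<^sub>M std_normal)"
  shows "J 0 + ennreal (s\<^sup>2) * (\<integral>\<^sup>+t. ennreal (lower_density p (sqrt ((g t)\<^sup>2 + (h t)\<^sup>2)) (f t)) \<partial>M) \<le> J s"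
proof -
  let ?R = "\<lambda>t. sqrt ((g t)\<^sup>2 + (h t)\<^sup>2)"
  have [measurable]: "(\<lambda>t. lower_density p (?R t) (f t)) \<in> borel_measurable M"
    using measurable_compose[OF _ lower_density_measurable[of p], of "\<lambda>t. (?R t, f t)" M] by simp
  have J: "J s = (\<integral>\<^sup>+t. \<integral>\<^sup>+z. ennreal (\<bar>s * f t + ?R t * z\<bar> powr p) \<partial>std_normal \<partial>M)" for s
    unfolding J_def by (rule nn_integral_std_normal_pair_swap[OF M]) measurable
  have "J 0 + ennreal (s\<^sup>2) * (\<integral>\<^sup>+t. ennreal (lower_density p (?R t) (f t)) \<partial>M)
    = (\<integral>\<^sup>+t. (\<integral>\<^sup>+z. ennreal (\<bar>?R t * z\<bar> powr p) \<partial>std_normal)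
        + ennreal (s\<^sup>2 * lower_density p (?R t) (f t)) \<partial>M)"
    unfolding J using lower_density_nonneg[OF p]
    by (simp add: nn_integral_add nn_integral_cmult ennreal_mult)
  also have "\<dots> \<le> J s"
    unfolding J by (intro nn_integral_mono nn_integral_std_normal_affine_powr_ge p s) auto
  finally show ?thesis .
qed

subsection \<open>Norms that are flat in one direction\<close>

text \<open>The constant is the minimum of the norm over the Euclidean unit circle, attained by
  compactness and positive by independence; homogeneity does the rest.\<close>

lemma norm_lincomb_lower_bound:
  fixes e2 e3 :: "'a::real_normed_vector"
  assumes "\<And>x y. x *\<^sub>R e2 + y *\<^sub>R e3 = 0 \<Longrightarrow> x = 0 \<and> y = 0"
  obtains c where "0 < c" "\<And>x y. c * norm (x, y) \<le> norm (x *\<^sub>R e2 + y *\<^sub>R e3)"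
proof -
  let ?r = "\<lambda>w :: real \<times> real. norm (fst w *\<^sub>R e2 + snd w *\<^sub>R e3)"
  have "continuous_on (sphere 0 1) ?r"
    by (intro continuous_intros)
  moreover have "compact (sphere (0 :: real \<times> real) 1)" "sphere (0 :: real \<times> real) 1 \<noteq> {}"
    by simp_all
  ultimately obtain w where w: "w \<in> sphere 0 1" "\<And>v. v \<in> sphere 0 1 \<Longrightarrow> ?r w \<le> ?r v"
    using continuous_attains_inf[of "sphere (0 :: real \<times> real) 1" ?r] by blast
  show ?thesis
  proof
    have "w \<noteq> 0" using w(1) by auto
    then show "0 < ?r w" using assms[of "fst w" "snd w"] by (auto simp: prod_eq_iff)
    fix x y :: real
    show "?r w * norm (x, y) \<le> norm (x *\<^sub>R e2 + y *\<^sub>R e3)"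
    proof (cases "(x, y) = 0")
      case False
      define m where "m = norm (x, y)"
      have m: "0 < m" using False by (simp add: m_def)
      have eq: "x *\<^sub>R e2 + y *\<^sub>R e3 = m *\<^sub>R ((x / m) *\<^sub>R e2 + (y / m) *\<^sub>R e3)"
        using m by (simp add: scaleR_add_right)
      have "norm ((1 / m) *\<^sub>R (x, y)) = 1"
        using m unfolding norm_scaleR by (simp flip: m_def)
      then have "?r w \<le> ?r (x / m, y / m)"
        by (intro w(2)) simp
      then show ?thesis
        unfolding eq m_def[symmetric] norm_scaleR using m by simp
    qed (simp add: zero_prod_def)
  qed
qed

lemma coord_norm_scale:
  "0 < r \<Longrightarrow> coord_norm e1 e2 e3 s x y = r * coord_norm e1 e2 e3 (s / r) (x / r) (y / r)"
proof -
  assume "0 < r"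
  then have "s *\<^sub>R e1 + x *\<^sub>R e2 + y *\<^sub>R e3 = r *\<^sub>R ((s / r) *\<^sub>R e1 + (x / r) *\<^sub>R e2 + (y / r) *\<^sub>R e3)"
    by (simp add: scaleR_add_right)
  then show ?thesis using \<open>0 < r\<close> by (simp add: coord_norm_def)
qed

lemma coord_norm_0: "coord_norm e1 e2 e3 0 x y = norm (x *\<^sub>R e2 + y *\<^sub>R e3)"
  by (simp add: coord_norm_def)

lemma coord_norm_nonneg: "0 \<le> coord_norm e1 e2 e3 s x y"
  by (simp add: coord_norm_def)

lemma borel_measurable_coord_norm [measurable]:
  "(\<lambda>w. coord_norm e1 e2 e3 s (fst w) (snd w)) \<in> borel_measurable (borel \<Otimes>\<^sub>M borel)"
  unfolding borel_prod coord_norm_def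
  by (intro borel_measurable_continuous_onI continuous_intros)

text \<open>The form in which the smoothness hypotheses enter: \<open>flat\<close> says that the
  increment of the norm along \<open>e1\<close> is \<open>o(s^2)\<close>, uniformly over the unit
  sphere of the plane of \<open>e2\<close> and \<open>e3\<close>. Derivatives no longer
  occur.\<close>

locale flat_direction =
  fixes e1 e2 e3 :: "'a::real_normed_vector" and p :: real
  assumes p: "0 < p" "p \<le> 2"
    and indep: "\<And>x y. x *\<^sub>R e2 + y *\<^sub>R e3 = 0 \<Longrightarrow> x = 0 \<and> y = 0"
    and norm_e1: "norm e1 = 1"
    and flat: "\<And>e. 0 < e \<Longrightarrow> \<exists>d>0. \<forall>s x y. norm (x *\<^sub>R e2 + y *\<^sub>R e3) = 1 \<longrightarrow> \<bar>s\<bar> < d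
      \<longrightarrow> \<bar>coord_norm e1 e2 e3 s x y - 1\<bar> \<le> e * s\<^sup>2"
begin

abbreviation N :: "real \<Rightarrow> real \<Rightarrow> real \<Rightarrow> real"
  where "N \<equiv> coord_norm e1 e2 e3"

lemma N_triangle: "\<bar>N s x y - N 0 x y\<bar> \<le> \<bar>s\<bar>"
  using norm_triangle_ineq3[of "s *\<^sub>R e1 + x *\<^sub>R e2 + y *\<^sub>R e3" "x *\<^sub>R e2 + y *\<^sub>R e3"] norm_e1
  by (simp add: coord_norm_def add.assoc)

lemma N_powr_unit:
  assumes "N 0 x y = 1"
  shows "\<bar>N s x y powr p - 1\<bar> \<le> \<bar>N s x y - 1\<bar> * (2 + \<bar>s\<bar>)"
proof -
  have "\<bar>N s x y powr p - 1\<bar> \<le> \<bar>N s x y - 1\<bar> * (N s x y + 1)"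
    by (intro abs_powr_minus_one_le p coord_norm_nonneg)
  also have "\<dots> \<le> \<bar>N s x y - 1\<bar> * (2 + \<bar>s\<bar>)"
    using N_triangle[of s x y] assms by (intro mult_left_mono) auto
  finally show ?thesis .
qed

text \<open>Homogeneity reduces every increment to one based on the unit sphere, with
  \<open>s\<close> replaced by \<open>s / r\<close>.\<close>

lemma N_powr_diff:
  assumes r: "r = N 0 x y" "0 < r"
  shows "N 0 (x / r) (y / r) = 1"
    and "\<bar>N s x y powr p - r powr p\<bar> = r powr p * \<bar>N (s / r) (x / r) (y / r) powr p - 1\<bar>"
proof -
  show "N 0 (x / r) (y / r) = 1"
    using coord_norm_scale[OF r(2), of e1 e2 e3 0 x y] r by simp
  have "N s x y powr p - r powr p = r powr p * (N (s / r) (x / r) (y / r) powr p - 1)"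
    unfolding coord_norm_scale[OF r(2), of e1 e2 e3 s x y]
    using r by (simp add: powr_mult coord_norm_nonneg algebra_simps)
  then show "\<bar>N s x y powr p - r powr p\<bar> = r powr p * \<bar>N (s / r) (x / r) (y / r) powr p - 1\<bar>"
    by (simp add: abs_mult)
qed

text \<open>On the unit sphere, flatness with \<open>e = 1\<close> covers small \<open>s\<close> and
  the triangle inequality covers the rest. Rescaling \<open>s\<close> to \<open>s / r\<close> turns
  \<open>r powr p\<close> into \<open>r powr (p - 2)\<close>.\<close>

lemma N_powr_diff_bound:
  obtains C where "0 \<le> C"
    "\<And>s x y. 0 < N 0 x y \<Longrightarrow>
      \<bar>N s x y powr p - N 0 x y powr p\<bar> \<le> C * s\<^sup>2 * N 0 x y powr (p - 2)"
proof -
  from flat[of 1] obtain d where d: "0 < d"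
    and d1: "\<And>s x y. norm (x *\<^sub>R e2 + y *\<^sub>R e3) = 1 \<Longrightarrow> \<bar>s\<bar> < d \<Longrightarrow> \<bar>N s x y - 1\<bar> \<le> 1 * s\<^sup>2"
    by auto
  \<comment> \<open>The sum of the constants for \<open>|s| < d\<close> and for
    \<open>|s| >= d\<close>.\<close>
  define C where "C = 2 + d + (2 / d + 1)"
  have unit: "\<bar>N s x y powr p - 1\<bar> \<le> C * s\<^sup>2" if xy: "N 0 x y = 1" for s x y
  proof (cases "\<bar>s\<bar> < d")
    case True
    have "\<bar>N s x y powr p - 1\<bar> \<le> s\<^sup>2 * (2 + d)"
      using d1[of x y s] xy True
      by (intro order_trans[OF N_powr_unit[OF xy]] mult_mono) (auto simp: coord_norm_0)
    also have "\<dots> \<le> C * s\<^sup>2"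
      unfolding C_def using d by (simp add: algebra_simps)
    finally show ?thesis .
  next
    case False
    have "\<bar>N s x y powr p - 1\<bar> \<le> \<bar>s\<bar> * (2 + \<bar>s\<bar>)"
      using N_triangle[of s x y] xy
      by (intro order_trans[OF N_powr_unit[OF xy]] mult_right_mono) auto
    \<comment> \<open>Here \<open>|s| >= d\<close> lets the constant 2 be absorbed into a multiple
      of \<open>|s|\<close>.\<close>
    also have "\<dots> \<le> \<bar>s\<bar> * (2 / d * \<bar>s\<bar> + \<bar>s\<bar>)"
      using False d by (intro mult_left_mono add_right_mono) (auto simp: field_simps)
    also have "\<dots> = (2 / d + 1) * s\<^sup>2"
      by (simp add: algebra_simps power2_eq_square flip: abs_mult)
    also have "\<dots> \<le> C * s\<^sup>2"
      unfolding C_def using d by (intro mult_right_mono) auto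
    finally show ?thesis .
  qed
  show ?thesis
  proof
    show "0 \<le> C" using d by (simp add: C_def)
    fix s x y assume r: "0 < N 0 x y"
    let ?r = "N 0 x y"
    have "\<bar>N s x y powr p - ?r powr p\<bar> \<le> ?r powr p * (C * (s / ?r)\<^sup>2)"
      unfolding N_powr_diff(2)[OF refl r]
      by (intro mult_left_mono unit N_powr_diff(1)[OF refl r]) auto
    also have "\<dots> = C * s\<^sup>2 * ?r powr (p - 2)"
      using r by (simp add: powr_diff power_divide)
    finally show "\<bar>N s x y powr p - ?r powr p\<bar> \<le> C * s\<^sup>2 * ?r powr (p - 2)" .
  qed
qed

lemma N_powr_diff_limit:
  assumes r: "0 < N 0 x y"
  shows "((\<lambda>s. \<bar>N s x y powr p - N 0 x y powr p\<bar> / s\<^sup>2) \<longlongrightarrow> 0) (at 0)"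
proof (rule tendstoI)
  let ?r = "N 0 x y"
  fix e :: real assume e: "0 < e"
  \<comment> \<open>Chosen so that \<open>3 * e' * r powr (p - 2) = e / 2\<close>; the 3 bounds the
    factor \<open>2 + |s / r|\<close> once \<open>|s / r| <= 1\<close>.\<close>
  define e' where "e' = e / (6 * ?r powr (p - 2))"
  have e': "0 < e'" using e r by (simp add: e'_def)
  from flat[OF this] obtain d where d: "0 < d"
    and d1: "\<And>s x y. norm (x *\<^sub>R e2 + y *\<^sub>R e3) = 1 \<Longrightarrow> \<bar>s\<bar> < d \<Longrightarrow> \<bar>N s x y - 1\<bar> \<le> e' * s\<^sup>2"
    by auto
  have "\<bar>N s x y powr p - ?r powr p\<bar> / s\<^sup>2 < e" if s: "s \<noteq> 0" "\<bar>s\<bar> < min d 1 * ?r" for s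
  proof -
    let ?s = "s / ?r"
    have s': "\<bar>?s\<bar> < d" "\<bar>?s\<bar> \<le> 1"
      using s r mult_right_mono[of "min d 1" d ?r] mult_right_mono[of "min d 1" 1 ?r]
      by (simp_all add: divide_less_eq, linarith+)
    have "\<bar>N ?s (x / ?r) (y / ?r) powr p - 1\<bar> \<le> (e' * ?s\<^sup>2) * 3"
      using d1[OF _ s'(1), of "x / ?r" "y / ?r"] N_powr_diff(1)[OF refl r] s' e'
      by (intro order_trans[OF N_powr_unit] mult_mono) (auto simp: coord_norm_0)
    then have "\<bar>N s x y powr p - ?r powr p\<bar> \<le> ?r powr p * ((e' * ?s\<^sup>2) * 3)"
      unfolding N_powr_diff(2)[OF refl r] by (intro mult_left_mono) auto
    also have "\<dots> = e / 2 * s\<^sup>2"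
      using r by (simp add: e'_def powr_diff power_divide)
    finally have "\<bar>N s x y powr p - ?r powr p\<bar> / s\<^sup>2 \<le> e / 2"
      using s(1) by (simp add: divide_le_eq)
    then show ?thesis using e by linarith
  qed
  then show "\<forall>\<^sub>F s in at 0. dist (\<bar>N s x y powr p - N 0 x y powr p\<bar> / s\<^sup>2) 0 < e"
    unfolding eventually_at using r d
    by (intro exI[of _ "min d 1 * ?r"]) (auto simp: abs_div)
qed

end

section \<open>Gaussian averages of the norm\<close>

text \<open>Needed to cancel the average at \<open>s = 0\<close> later. The power is at most 1 plus
  the square of the norm, which has a quadratic bound in the Gaussian coordinates.\<close>

lemma (in flat_direction) nn_integral_N_powr_finite:
  "(\<integral>\<^sup>+w. ennreal (N 0 (fst w) (snd w) powr p) \<partial>(std_normal \<Otimes>\<^sub>M std_normal)) < \<infinity>"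
proof -
  interpret P: pair_prob_space std_normal std_normal ..
  let ?B = "\<lambda>w::real \<times> real. 1 + (2 * (norm e2)\<^sup>2 * (fst w)\<^sup>2 + 2 * (norm e3)\<^sup>2 * (snd w)\<^sup>2)"
  have "integrable (std_normal \<Otimes>\<^sub>M std_normal) (\<lambda>w. (fst w)\<^sup>2)"
    by (rule P.Fubini_integrable) (use integrable_std_normal_power[of 2] in auto)
  moreover have "integrable (std_normal \<Otimes>\<^sub>M std_normal) (\<lambda>w. (snd w)\<^sup>2)"
    by (rule P.Fubini_integrable) (use integrable_std_normal_power[of 2] in auto)
  ultimately have B: "integrable (std_normal \<Otimes>\<^sub>M std_normal) ?B" by auto
  have "N 0 (fst w) (snd w) powr p \<le> ?B w" for w
  proof -
    have "N 0 (fst w) (snd w) powr p \<le> 1 + (N 0 (fst w) (snd w))\<^sup>2"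
      using powr_le_1_plus_square[OF p, of "N 0 (fst w) (snd w)"] by (simp add: coord_norm_nonneg)
    also have "(N 0 (fst w) (snd w))\<^sup>2 \<le> (\<bar>fst w\<bar> * norm e2 + \<bar>snd w\<bar> * norm e3)\<^sup>2"
      using norm_triangle_ineq[of "fst w *\<^sub>R e2" "snd w *\<^sub>R e3"]
      by (intro power_mono) (auto simp: coord_norm_0)
    also have "\<dots> \<le> 2 * (norm e2)\<^sup>2 * (fst w)\<^sup>2 + 2 * (norm e3)\<^sup>2 * (snd w)\<^sup>2"
      using sum_squares_bound[of "\<bar>fst w\<bar> * norm e2" "\<bar>snd w\<bar> * norm e3"]
      by (simp add: power2_sum power_mult_distrib algebra_simps)
    finally show ?thesis by simp
  qed
  then have "(\<integral>\<^sup>+w. ennreal (N 0 (fst w) (snd w) powr p) \<partial>(std_normal \<Otimes>\<^sub>M std_normal))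
      \<le> (\<integral>\<^sup>+w. ennreal (?B w) \<partial>(std_normal \<Otimes>\<^sub>M std_normal))"
    by (intro nn_integral_mono ennreal_leI)
  also have "\<dots> < \<infinity>"
    using B by (subst nn_integral_eq_integral) auto
  finally show ?thesis .
qed

text \<open>Dominated convergence along \<open>1 / Suc n\<close>: the quotients tend to 0 off the
  origin and are bounded by a multiple of the norm to the power \<open>p - 2\<close>.\<close>

lemma (in flat_direction) nn_integral_N_powr_diff_tendsto:
  "(\<lambda>n. \<integral>\<^sup>+w. ennreal (\<bar>N (1 / real (Suc n)) (fst w) (snd w) powr p - N 0 (fst w) (snd w) powr p\<bar>
      / (1 / real (Suc n))\<^sup>2) \<partial>(std_normal \<Otimes>\<^sub>M std_normal)) \<longlonglongrightarrow> 0"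
proof -
  let ?P = "std_normal \<Otimes>\<^sub>M std_normal" and ?s = "\<lambda>n. 1 / real (Suc n)"
  let ?D = "\<lambda>n w. \<bar>N (?s n) (fst w) (snd w) powr p - N 0 (fst w) (snd w) powr p\<bar> / (?s n)\<^sup>2"
  obtain C where C: "0 \<le> C" "\<And>s x y. 0 < N 0 x y \<Longrightarrow>
      \<bar>N s x y powr p - N 0 x y powr p\<bar> \<le> C * s\<^sup>2 * N 0 x y powr (p - 2)"
    using N_powr_diff_bound by blast
  obtain c where c: "0 < c" "\<And>x y. c * norm (x, y) \<le> norm (x *\<^sub>R e2 + y *\<^sub>R e3)"
    using norm_lincomb_lower_bound[of e2 e3] indep by blast
  \<comment> \<open>Half of the exponent \<open>p - 2\<close> goes to each coordinate;
    \<open>p > 0\<close> is exactly what makes \<open>a > -1\<close>.\<close>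
  define a where "a = (p - 2) / 2"
  have a: "-1 < a" "a \<le> 0" using p by (auto simp: a_def)
  let ?B = "\<lambda>w. C * (c\<^sup>2) powr a * (\<bar>fst w\<bar> powr a * \<bar>snd w\<bar> powr a)"
  have pos: "0 < N 0 x y" if "x \<noteq> 0" for x y
    using indep[of x y] that by (auto simp: coord_norm_0)
  have bound: "?D n w \<le> ?B w" if w: "fst w \<noteq> 0" "snd w \<noteq> 0" for n w
  proof -
    let ?r = "N 0 (fst w) (snd w)"
    note r = pos[OF w(1), of "snd w"]
    \<comment> \<open>The norm dominates both \<open>c * |fst w|\<close> and
      \<open>c * |snd w|\<close>, hence its square dominates their product; the exponent
      \<open>a <= 0\<close> reverses this inequality.\<close>
    have "c * \<bar>fst w\<bar> \<le> c * norm w" "c * \<bar>snd w\<bar> \<le> c * norm w"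
      using norm_fst_le[of "fst w" "snd w"] norm_snd_le[of "snd w" "fst w"] c(1) by simp_all
    then have "c * \<bar>fst w\<bar> \<le> ?r" "c * \<bar>snd w\<bar> \<le> ?r"
      using c(2)[of "fst w" "snd w"] by (simp_all add: coord_norm_0)
    then have "(c * \<bar>fst w\<bar>) * (c * \<bar>snd w\<bar>) \<le> ?r * ?r"
      using c(1) r by (intro mult_mono) auto
    then have "(?r * ?r) powr a \<le> ((c * \<bar>fst w\<bar>) * (c * \<bar>snd w\<bar>)) powr a"
      using w c a by (intro powr_mono2') auto
    moreover have "(?r * ?r) powr a = ?r powr (p - 2)"
      using r by (simp add: powr_mult a_def flip: powr_add)
    moreover have "((c * \<bar>fst w\<bar>) * (c * \<bar>snd w\<bar>)) powr a = (c\<^sup>2) powr a * (\<bar>fst w\<bar> powr a * \<bar>snd w\<bar> powr a)"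
      using c by (simp add: powr_mult power2_eq_square)
    ultimately have "C * ?r powr (p - 2) \<le> ?B w"
      using C(1) by (simp add: mult_left_mono mult.assoc)
    moreover have "?D n w \<le> C * ?r powr (p - 2)"
      using C(2)[OF r, of "?s n"] by (simp add: divide_le_eq mult_ac del: of_nat_Suc)
    ultimately show ?thesis by linarith
  qed
  have lim: "(\<lambda>n. ?D n w) \<longlonglongrightarrow> 0" if w: "fst w \<noteq> 0" for w
  proof -
    have "filterlim ?s (at 0) sequentially"
      using LIMSEQ_inverse_real_of_nat by (auto simp: filterlim_at inverse_eq_divide)
    from filterlim_compose[OF N_powr_diff_limit[OF pos[OF w]] this] show ?thesis .
  qed
  have "(\<lambda>n. \<integral>\<^sup>+w. ennreal (?D n w) \<partial>?P) \<longlonglongrightarrow> (\<integral>\<^sup>+w. 0 \<partial>?P)"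
  proof (rule nn_integral_dominated_convergence)
    show "AE w in ?P. ennreal (?D n w) \<le> ennreal (?B w)" for n
      using AE_std_normal_pair_nonzero by eventually_elim (intro ennreal_leI bound, auto)
    show "AE w in ?P. (\<lambda>n. ennreal (?D n w)) \<longlonglongrightarrow> 0"
      using AE_std_normal_pair_nonzero
      by eventually_elim (use lim in \<open>auto intro!: tendsto_ennrealI simp flip: ennreal_0\<close>)
    have "integrable ?P ?B"
      using integrable_std_normal_pair_powr_neg[OF a] by auto
    then show "(\<integral>\<^sup>+w. ennreal (?B w) \<partial>?P) < \<infinity>"
      using C(1) by (subst nn_integral_eq_integral) auto
  qed measurable
  then show ?thesis by simp
qed

section \<open>Contradiction from an isometric embedding\<close>

text \<open>For fixed \<open>s\<close>, \<open>x\<close>, \<open>y\<close> only five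
  almost-everywhere identities are combined, so null sets depending on the coefficients do no
  harm.\<close>

lemma embedding_coord_norm:
  assumes T: "linear_into_Lp p T" "\<And>x. Lp_norm p (T x) = norm x" and p: "0 < p"
  shows "(\<integral>\<^sup>+t. ennreal (\<bar>s * T e1 t + x * T e2 t + y * T e3 t\<bar> powr p) \<partial>leb01)
    = ennreal (coord_norm e1 e2 e3 s x y powr p)"
proof -
  have add: "AE t in leb01. T (u + v) t = T u t + T v t" for u v
    using T(1) by (auto simp: linear_into_Lp_def)
  have scale: "AE t in leb01. T (k *\<^sub>R u) t = k * T u t" for k u
    using T(1) by (auto simp: linear_into_Lp_def)
  let ?v = "s *\<^sub>R e1 + x *\<^sub>R e2 + y *\<^sub>R e3"
  have "AE t in leb01. s * T e1 t + x * T e2 t + y * T e3 t = T ?v t"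
    using add[of "s *\<^sub>R e1 + x *\<^sub>R e2" "y *\<^sub>R e3"] add[of "s *\<^sub>R e1" "x *\<^sub>R e2"]
      scale[of s e1] scale[of x e2] scale[of y e3]
    by eventually_elim simp
  then have "(\<integral>\<^sup>+t. ennreal (\<bar>s * T e1 t + x * T e2 t + y * T e3 t\<bar> powr p) \<partial>leb01)
      = (\<integral>\<^sup>+t. ennreal (\<bar>T ?v t\<bar> powr p) \<partial>leb01)"
    by (rule nn_integral_cong_AE[OF eventually_mono]) simp
  also have "\<dots> = ennreal (\<integral>t. \<bar>T ?v t\<bar> powr p \<partial>leb01)"
    using T(1) by (intro nn_integral_eq_integral) (auto simp: linear_into_Lp_def Lp_set_def)
  also have "(\<integral>t. \<bar>T ?v t\<bar> powr p \<partial>leb01) = Lp_norm p (T ?v) powr p"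
    using p by (simp add: Lp_norm_def powr_powr)
  finally show ?thesis by (simp add: T(2) coord_norm_def)
qed

text \<open>Growth on the side of \<open>L_p\<close> bounds the integral of
  \<open>lower_density\<close> by averaged difference quotients of the norm, which tend to 0. That
  integral therefore vanishes, and strict positivity of \<open>lower_density\<close> off
  \<open>f = 0\<close> forces \<open>T e1\<close> to be null.\<close>

lemma (in flat_direction) not_embeds: "\<not> embeds_isometrically_in_Lp TYPE('a) p"
proof
  assume "embeds_isometrically_in_Lp TYPE('a) p"
  then obtain T :: "'a \<Rightarrow> real \<Rightarrow> real"
    where T: "linear_into_Lp p T" "\<And>x. Lp_norm p (T x) = norm x"
    by (auto simp: embeds_isometrically_in_Lp_def)
  have meas [measurable]: "T x \<in> borel_measurable leb01" for x
    using T(1) by (auto simp: linear_into_Lp_def Lp_set_def)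
  have "finite_measure leb01"
    by (intro finite_measure_lebesgue_on) auto
  then have sigma: "sigma_finite_measure leb01"
    by (simp add: finite_measure_def)
  note coord = embedding_coord_norm[OF T p(1), of _ e1 _ e2 _ e3]
  let ?P = "std_normal \<Otimes>\<^sub>M std_normal" and ?s = "\<lambda>n. 1 / real (Suc n)"
  let ?L = "\<lambda>t. lower_density p (sqrt ((T e2 t)\<^sup>2 + (T e3 t)\<^sup>2)) (T e1 t)"
  define \<Lambda> where "\<Lambda> = (\<integral>\<^sup>+t. ennreal (?L t) \<partial>leb01)"
  define J where "J s = (\<integral>\<^sup>+w. ennreal (N s (fst w) (snd w) powr p) \<partial>?P)" for s
  have [measurable]: "?L \<in> borel_measurable leb01"
    using measurable_compose[OF _ lower_density_measurable[of p],
        of "\<lambda>t. (sqrt ((T e2 t)\<^sup>2 + (T e3 t)\<^sup>2), T e1 t)" leb01] by simp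
  have le: "\<Lambda> \<le> (\<integral>\<^sup>+w. ennreal (\<bar>N s (fst w) (snd w) powr p - N 0 (fst w) (snd w) powr p\<bar> / s\<^sup>2) \<partial>?P)"
    (is "_ \<le> ?D") if s: "0 < s" "s \<le> 1" for s
  proof -
    have "J 0 + ennreal (s\<^sup>2) * \<Lambda> \<le> J s"
      using nn_integral_std_normal_pair_growth[OF sigma meas meas meas p s, of e1 e2 e3]
      unfolding coord J_def \<Lambda>_def .
    also have "J s \<le> (\<integral>\<^sup>+w. ennreal (N 0 (fst w) (snd w) powr p)
        + ennreal (s\<^sup>2) * ennreal (\<bar>N s (fst w) (snd w) powr p - N 0 (fst w) (snd w) powr p\<bar> / s\<^sup>2) \<partial>?P)"
      unfolding J_def using s
      by (intro nn_integral_mono) (simp flip: ennreal_mult ennreal_plus add: ennreal_leI)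
    also have "\<dots> = J 0 + ennreal (s\<^sup>2) * ?D"
      unfolding J_def by (subst nn_integral_add) (auto simp: nn_integral_cmult)
    \<comment> \<open>Subtracting \<open>J 0\<close> in the extended reals is legitimate because it
      is finite.\<close>
    finally have "ennreal (s\<^sup>2) * \<Lambda> \<le> ennreal (s\<^sup>2) * ?D"
      using nn_integral_N_powr_finite by (subst (asm) ennreal_add_left_cancel_le) (auto simp: J_def)
    then show ?thesis
      using s by (simp add: ennreal_mult_le_mult_iff)
  qed
  have "\<Lambda> \<le> 0"
    by (rule LIMSEQ_le_const[OF nn_integral_N_powr_diff_tendsto]) (use le in auto)
  then have "AE t in leb01. ?L t \<le> 0"
    by (simp add: \<Lambda>_def nn_integral_0_iff_AE ennreal_eq_0_iff)
  then have "AE t in leb01. T e1 t = 0"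
    by eventually_elim (use lower_density_pos[OF p] in \<open>force simp: not_less[symmetric]\<close>)
  then have "(\<integral>t. \<bar>T e1 t\<bar> powr p \<partial>leb01) = (\<integral>t. 0 \<partial>leb01)"
    by (intro integral_cong_AE) (auto elim: eventually_mono)
  then have "Lp_norm p (T e1) = 0"
    by (simp add: Lp_norm_def)
  then show False using T(2) norm_e1 by simp
qed

theorem theorem1:
  fixes e1 e2 e3 :: "'a::real_normed_vector"
  assumes basis: "distinct [e1, e2, e3]" "independent {e1, e2, e3}"
      "span {e1, e2, e3} = (UNIV :: 'a set)"
    and normalized: "norm e1 = 1" "norm e2 = 1" "norm e3 = 1"
    and smooth: "\<And>x2 x3. (x2, x3) \<noteq> (0, 0) \<Longrightarrow>
      twice_continuously_differentiable (\<lambda>x1. coord_norm e1 e2 e3 x1 x2 x3)"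
    and d1_zero: "\<And>x2 x3. (x2, x3) \<noteq> (0, 0) \<Longrightarrow> coord_norm_d1 e1 e2 e3 0 x2 x3 = 0"
    and d2_zero: "\<And>x2 x3. (x2, x3) \<noteq> (0, 0) \<Longrightarrow> coord_norm_d2 e1 e2 e3 0 x2 x3 = 0"
    and bounded_d2: "\<exists>K::real. \<forall>x1 x2 x3. norm (x2 *\<^sub>R e2 + x3 *\<^sub>R e3) = 1 \<longrightarrow>
      coord_norm_d2 e1 e2 e3 x1 x2 x3 \<le> K"
    and uniform: "uniform_limit {(x2, x3). norm (x2 *\<^sub>R e2 + x3 *\<^sub>R e3) = 1}
      (\<lambda>x1 (x2, x3). coord_norm_d2 e1 e2 e3 x1 x2 x3) (\<lambda>_. 0) (at 0)"
  shows "\<forall>p::real. 0 < p \<and> p \<le> 2 \<longrightarrow> \<not> embeds_isometrically_in_Lp TYPE('a) p"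
proof (intro allI impI)
  fix p :: real assume p: "0 < p \<and> p \<le> 2"
  have ind: "x = 0 \<and> y = 0" if "x *\<^sub>R e2 + y *\<^sub>R e3 = 0" for x y
  proof -
    have "independent {e2, e3}" using basis(2) by (rule independent_mono) auto
    \<comment> \<open>The coefficient function tells the two vectors apart because they are
      distinct.\<close>
    moreover have "(\<Sum>v\<in>{e2, e3}. (if v = e2 then x else y) *\<^sub>R v) = 0"
      using that basis(1) by auto
    ultimately have "(if v = e2 then x else y) = 0" if "v \<in> {e2, e3}" for v
      using independentD[of "{e2, e3}" "{e2, e3}" "\<lambda>v. if v = e2 then x else y" v] that by auto
    from this[of e2] this[of e3] show ?thesis using basis(1) by auto
  qed
  have "flat_direction e1 e2 e3 p"
  proof
    fix e :: real assume "0 < e"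
    from uniform_limitD[OF uniform this] obtain d where d: "0 < d"
      and d2: "\<And>u x y. u \<noteq> 0 \<Longrightarrow> \<bar>u\<bar> < d \<Longrightarrow> norm (x *\<^sub>R e2 + y *\<^sub>R e3) = 1 \<Longrightarrow>
        \<bar>coord_norm_d2 e1 e2 e3 u x y\<bar> < e"
      unfolding eventually_at by auto
    have "\<bar>coord_norm e1 e2 e3 s x y - 1\<bar> \<le> e * s\<^sup>2"
      if xy: "norm (x *\<^sub>R e2 + y *\<^sub>R e3) = 1" and s: "\<bar>s\<bar> < d" for s x y
    proof -
      have nz: "(x, y) \<noteq> (0, 0)" using xy by auto
      have "\<bar>coord_norm e1 e2 e3 s x y - coord_norm e1 e2 e3 0 x y\<bar> \<le> e * s\<^sup>2"
      proof (rule flat_function_bound[OF smooth[OF nz] _ _ s])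
        show "deriv (\<lambda>x1. coord_norm e1 e2 e3 x1 x y) 0 = 0"
          using d1_zero[OF nz] by (simp add: coord_norm_d1_def)
        fix u :: real assume "\<bar>u\<bar> < d"
        \<comment> \<open>The limit at 0 says nothing about \<open>u = 0\<close> itself; that point
          is covered by \<open>d2_zero\<close>.\<close>
        then have "\<bar>coord_norm_d2 e1 e2 e3 u x y\<bar> \<le> e"
          using d2[of u x y] d2_zero[OF nz] xy \<open>0 < e\<close> by (cases "u = 0") auto
        then show "\<bar>deriv (deriv (\<lambda>x1. coord_norm e1 e2 e3 x1 x y)) u\<bar> \<le> e"
          by (simp add: coord_norm_d2_def coord_norm_d1_def)
      qed
      then show ?thesis using xy by (simp add: coord_norm_0)
    qed
    then show "\<exists>d>0. \<forall>s x y. norm (x *\<^sub>R e2 + y *\<^sub>R e3) = 1 \<longrightarrow> \<bar>s\<bar> < d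
      \<longrightarrow> \<bar>coord_norm e1 e2 e3 s x y - 1\<bar> \<le> e * s\<^sup>2"
      using d by blast
  qed (use p normalized ind in auto)
  then show "\<not> embeds_isometrically_in_Lp TYPE('a) p"
    by (rule flat_direction.not_embeds)
qed

end
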